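(* If $r$ is a balanced rotor type, then $|UU(r)|\le |r|$, $|UD(r)|\le |r|$, $|DU(r)|\le |r|$, and $|DD(r)|\le |r|$.
   Context: A rotor type is an infinite periodic sequence $r=(r^{(1)},r^{(2)},\dots)$ of natural numbers (states), with (fundamental) period $|r|$. A two-state rotor type is written over the states $\{1,2\}$ with the convention $r^{(1)}=1$; it is balanced if its two states occur equally often in a period. A rotor-router network: a finite digraph, a source vertex, target vertices of outdegree $0$, and at each non-target vertex $v$ a periodic sequence $e_v^{(1)},e_v^{(2)},\dots$ of out-edges; a particle starts at the source, on its $n$-th visit to a non-target vertex $v$ leaves along $e_v^{(n)}$, and whenever it reaches a target it is returned to the source; the hitting sequence is the (periodic) sequence of targets reached. The compressor network for $r$ has non-target vertices $1$ (source), $2,3$ and targets $4,5$. On the $n$-th departure: from vertex $1$ the particle goes to vertex $2$ if $r^{(n)}=1$ and to vertex $3$ if $r^{(n)}=2$; from vertex $2$, in variant $U$ it goes to vertex $1$ if $r^{(n)}=1$ and to target $4$ if $r^{(n)}=2$, in variant $D$ to target $4$ if $r^{(n)}=1$ and to vertex $1$ if $r^{(n)}=2$; from vertex $3$ likewise with target $5$. For $X,Y\in\{U,D\}$, $XY(r)$ is the hitting sequence with variant $X$ at vertex $2$ and $Y$ at vertex $3$ (with $4$ written as $1$ and $5$ as $2$), and $|XY(r)|$ is its period. *)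

theory Defs
  imports "Graph_Theory.Digraph" "HOL-Library.Infinite_Set"
begin

(* Sequences are indexed from 0: r n stands for the mathematical r^(n+1). *)

definition is_period :: "(nat \<Rightarrow> 'a) \<Rightarrow> nat \<Rightarrow> bool" where
  "is_period r p \<longleftrightarrow> 0 < p \<and> (\<forall>n. r (n + p) = r n)"

definition periodic :: "(nat \<Rightarrow> 'a) \<Rightarrow> bool" where
  "periodic r \<longleftrightarrow> (\<exists>p. is_period r p)"

(* Only meaningful for periodic sequences. *)
definition period :: "(nat \<Rightarrow> 'a) \<Rightarrow> nat" where
  "period r = (LEAST p. is_period r p)"

definition two_state_rotor_type :: "(nat \<Rightarrow> nat) \<Rightarrow> bool" where
  "two_state_rotor_type r \<longleftrightarrow> periodic r \<and> range r = {1, 2} \<and> r 0 = 1"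

definition balanced :: "(nat \<Rightarrow> nat) \<Rightarrow> bool" where
  "balanced r \<longleftrightarrow> two_state_rotor_type r \<and>
     card {n. n < period r \<and> r n = 1} = card {n. n < period r \<and> r n = 2}"

record ('a, 'b) rr_network =
  graph :: "('a, 'b) pre_digraph"
  source :: 'a
  targets :: "'a set"
  rotor :: "'a \<Rightarrow> nat \<Rightarrow> 'b"

locale rotor_router_network =
  fixes N :: "('a, 'b) rr_network"
  assumes fin_graph: "fin_digraph (graph N)"
    and source_vert: "source N \<in> verts (graph N)"
    and targets_verts: "targets N \<subseteq> verts (graph N)"
    and targets_sinks: "\<And>v. v \<in> targets N \<Longrightarrow> out_degree (graph N) v = 0"
    and rotor_out: "\<And>v n. v \<in> verts (graph N) - targets N \<Longrightarrow> rotor N v n \<in> out_arcs (graph N) v"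
    and rotor_periodic: "\<And>v. v \<in> verts (graph N) - targets N \<Longrightarrow> periodic (rotor N v)"

(* A configuration is the particle's position together with, for each vertex, the number of
   departures made from it so far. Being returned from a target to the source is a step of its own. *)
definition rr_step :: "('a, 'b) rr_network \<Rightarrow> 'a \<times> ('a \<Rightarrow> nat) \<Rightarrow> 'a \<times> ('a \<Rightarrow> nat)" where
  "rr_step N = (\<lambda>(v, c). if v \<in> targets N then (source N, c)
     else (head (graph N) (rotor N v (c v)), c(v := Suc (c v))))"

definition position :: "('a, 'b) rr_network \<Rightarrow> nat \<Rightarrow> 'a" where
  "position N t = fst ((rr_step N ^^ t) (source N, \<lambda>_. 0))"

(* Well-defined if some target is reached at infinitely many times. *)
definition hitting_sequence :: "('a, 'b) rr_network \<Rightarrow> nat \<Rightarrow> 'a" where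
  "hitting_sequence N n = position N (enumerate {t. position N t \<in> targets N} n)"

datatype variant = U | D

fun compressor_choice :: "variant \<Rightarrow> nat \<Rightarrow> nat \<Rightarrow> nat" where
  "compressor_choice U target state = (if state = 1 then 1 else target)"
| "compressor_choice D target state = (if state = 1 then target else 1)"

(* An arc is the pair of its tail and its head. The rotor at the targets 4 and 5 is never used. *)
definition compressor_network :: "variant \<Rightarrow> variant \<Rightarrow> (nat \<Rightarrow> nat) \<Rightarrow> (nat, nat \<times> nat) rr_network" where
  "compressor_network X Y r =
     \<lparr> graph = \<lparr> verts = {1, 2, 3, 4, 5},
                arcs = {(1, 2), (1, 3), (2, 1), (2, 4), (3, 1), (3, 5)},
                tail = fst, head = snd \<rparr>,
       source = 1,
       targets = {4, 5},
       rotor = (\<lambda>v n. (v, if v = 1 then (if r n = 1 then 2 else 3)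
                          else if v = 2 then compressor_choice X 4 (r n)
                          else compressor_choice Y 5 (r n))) \<rparr>"

definition compressor :: "variant \<Rightarrow> variant \<Rightarrow> (nat \<Rightarrow> nat) \<Rightarrow> nat \<Rightarrow> nat" where
  "compressor X Y r n = (if hitting_sequence (compressor_network X Y r) n = 4 then 1 else 2)"

lemma compressor_network_is_network:
  assumes "two_state_rotor_type r"
  shows "rotor_router_network (compressor_network X Y r)"
proof -
  obtain p where p: "is_period r p"
    using assms by (auto simp: two_state_rotor_type_def periodic_def)
  show ?thesis
  proof (rule rotor_router_network.intro)
    fix v assume "v \<in> verts (graph (compressor_network X Y r)) - targets (compressor_network X Y r)"
    show "periodic (rotor (compressor_network X Y r) v)"
      using p unfolding periodic_def is_period_def compressor_network_def
      by (intro exI[of _ p]) simp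
  next
    fix v n assume "v \<in> verts (graph (compressor_network X Y r)) - targets (compressor_network X Y r)"
    then show "rotor (compressor_network X Y r) v n \<in> out_arcs (graph (compressor_network X Y r)) v"
      by (cases X; cases Y) (auto simp: compressor_network_def out_arcs_def)
  next
    fix v assume "v \<in> targets (compressor_network X Y r)"
    then have "out_arcs (graph (compressor_network X Y r)) v = {}"
      by (auto simp: compressor_network_def out_arcs_def)
    then show "out_degree (graph (compressor_network X Y r)) v = 0"
      by (simp add: out_degree_def)
  next
    show "fin_digraph (graph (compressor_network X Y r))"
      by unfold_locales (auto simp: compressor_network_def)
  qed (simp_all add: compressor_network_def)
qed

end

theory Submission
  imports Defs
begin

text \<open>Let \<open>m\<close> be the number of occurrences of each state in a period of \<open>r\<close>. After \<open>4 m\<close> departures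
  from the source, vertices \<open>2\<close> and \<open>3\<close> have each been left exactly \<open>2 m = |r|\<close> times. All three
  rotors are then back at their initial phase, so the whole process repeats. In the meantime each of
  the vertices \<open>2\<close> and \<open>3\<close> has sent the particle to its target exactly \<open>m\<close> times, whichever variant it
  uses, so the hitting sequence repeats after \<open>2 m\<close> terms.\<close>

section \<open>Counting and enumerating shift-invariant sets of naturals\<close>

lemma card_Collect_less_Suc:
  "card {k. k < Suc n \<and> P k} = card {k. k < n \<and> P k} + (if P n then 1 else 0)"
proof -
  have "{k. k < Suc n \<and> P k} = (if P n then insert n {k. k < n \<and> P k} else {k. k < n \<and> P k})"
    by (auto simp: less_Suc_eq)
  then show ?thesis
    by simp
qed

lemma card_Collect_less_add:
  fixes m n :: nat
  assumes "\<And>k. P (k + m) \<longleftrightarrow> P k"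
  shows "card {k. k < n + m \<and> P k} = card {k. k < m \<and> P k} + card {k. k < n \<and> P k}"
proof (induction n)
  case (Suc n)
  then show ?case
    using assms[of n] by (simp add: card_Collect_less_Suc)
qed simp

text \<open>\<open>enumerate S\<close> is strictly increasing and reaches all of \<open>S\<close>,
  so the members below \<open>enumerate S j\<close> are the images of the indices below
  \<open>j\<close>; counting them recovers the index.\<close>

lemma enumerate_eqI:
  fixes S :: "nat set"
  assumes "infinite S" "x \<in> S" "card {s. s < x \<and> s \<in> S} = n"
  shows "enumerate S n = x"
proof -
  obtain j where j: "enumerate S j = x"
    using enumerate_Ex[OF assms(1,2)] by blast
  have mono: "strict_mono (enumerate S)"
    using assms(1) by (rule strict_mono_enumerate)
  have "{s. s < x \<and> s \<in> S} = enumerate S ` {..<j}"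
  proof (intro set_eqI iffI)
    fix s assume "s \<in> {s. s < x \<and> s \<in> S}"
    then obtain i where "s = enumerate S i" "s < x"
      using enumerate_Ex[OF assms(1)] by blast
    then show "s \<in> enumerate S ` {..<j}"
      using mono j by (auto simp: strict_mono_less)
  next
    fix s assume "s \<in> enumerate S ` {..<j}"
    then show "s \<in> {s. s < x \<and> s \<in> S}"
      using mono j enumerate_in_set[OF assms(1)] by (auto simp: strict_mono_less)
  qed
  moreover have "inj_on (enumerate S) {..<j}"
    using mono by (meson inj_on_subset strict_mono_imp_inj_on subset_UNIV)
  ultimately have "j = n"
    using assms(3) by (simp add: card_image)
  with j show ?thesis by simp
qed

lemma card_less_enumerate:
  fixes S :: "nat set"
  assumes "infinite S"
  shows "card {s. s < enumerate S n \<and> s \<in> S} = n"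
  using enumerate_eqI[OF assms enumerate_in_set[OF assms] refl]
    strict_mono_imp_inj_on[OF strict_mono_enumerate[OF assms]]
  by (metis injD)

lemma infinite_shift_invariant:
  fixes S :: "nat set"
  assumes "s \<in> S" "0 < T" "\<And>t. t + T \<in> S \<longleftrightarrow> t \<in> S"
  shows "infinite S"
proof -
  have "s + n * T \<in> S" for n
  proof (induction n)
    case (Suc n)
    then show ?case
      using assms(3)[of "s + n * T"] by (simp add: algebra_simps)
  qed (use assms(1) in simp)
  then have "range (\<lambda>n. s + n * T) \<subseteq> S"
    by auto
  moreover have "inj (\<lambda>n. s + n * T)"
    using assms(2) by (auto intro: injI)
  ultimately show ?thesis
    by (meson finite_imageD infinite_UNIV_nat infinite_super)
qed

text \<open>Below \<open>enumerate S n + T\<close> lie the members below \<open>T\<close> and,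
  shifted by \<open>T\<close>, the \<open>n\<close> members below
  \<open>enumerate S n\<close>.\<close>

lemma enumerate_shift_invariant:
  fixes S :: "nat set"
  assumes "infinite S" "\<And>t. t + T \<in> S \<longleftrightarrow> t \<in> S"
  shows "enumerate S (n + card {s. s < T \<and> s \<in> S}) = enumerate S n + T"
proof (rule enumerate_eqI[OF assms(1)])
  show "enumerate S n + T \<in> S"
    using assms enumerate_in_set by blast
  show "card {s. s < enumerate S n + T \<and> s \<in> S} = n + card {s. s < T \<and> s \<in> S}"
    using card_Collect_less_add[of "\<lambda>s. s \<in> S" T "enumerate S n"] assms
    by (simp add: card_less_enumerate)
qed

section \<open>Repetition in a general rotor-router network\<close>

abbreviation configuration :: "('a, 'b) rr_network \<Rightarrow> nat \<Rightarrow> 'a \<times> ('a \<Rightarrow> nat)" where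
  "configuration N t \<equiv> (rr_step N ^^ t) (source N, \<lambda>_. 0)"

text \<open>A counter matters only through the rotor entry it selects. The run from time
  \<open>T\<close> therefore copies the run from time 0, with each counter ahead by the constant
  \<open>c v\<close>; rotors at targets are never read.\<close>

lemma position_repeats:
  assumes "configuration N T = (source N, c)"
    and rot: "\<And>v n. v \<notin> targets N \<Longrightarrow> rotor N v (n + c v) = rotor N v n"
  shows "position N (t + T) = position N t"
proof -
  have "configuration N (t + T) =
      (fst (configuration N t), \<lambda>v. snd (configuration N t) v + c v)"
  proof (induction t)
    case (Suc t)
    then show ?case
      by (auto simp: rr_step_def rot fun_eq_iff split: prod.splits)
  qed (use assms(1) in simp)
  then show ?thesis
    by (simp add: position_def)
qed

text \<open>The set of hit times is invariant under the shift by \<open>T\<close>, so the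
  \<open>K\<close>-th next hit comes exactly \<open>T\<close> steps later, at the same vertex.
  \<open>0 < K\<close> also makes the hits infinite in number.\<close>

lemma is_period_hitting_sequence:
  assumes "configuration N T = (source N, c)"
    and "\<And>v n. v \<notin> targets N \<Longrightarrow> rotor N v (n + c v) = rotor N v n"
    and K: "card {t. t < T \<and> position N t \<in> targets N} = K" "0 < K"
  shows "is_period (hitting_sequence N) K"
proof -
  define S where "S = {t. position N t \<in> targets N}"
  have pos: "position N (t + T) = position N t" for t
    using assms(1,2) by (rule position_repeats)
  then have shift: "t + T \<in> S \<longleftrightarrow> t \<in> S" for t
    by (simp add: S_def)
  have card: "card {s. s < T \<and> s \<in> S} = K"
    using K(1) by (simp add: S_def)
  then obtain s where "s < T" "s \<in> S"
    using K(2) by (metis (mono_tags, lifting) card_gt_0_iff Collect_empty_eq)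
  then have "infinite S"
    using infinite_shift_invariant[OF _ _ shift, of s] by auto
  from enumerate_shift_invariant[OF this shift]
  show ?thesis
    using K(2) pos card unfolding is_period_def hitting_sequence_def S_def[symmetric] by simp
qed

lemma period_le: "is_period r p \<Longrightarrow> period r \<le> p"
  unfolding period_def by (rule Least_le)

lemma is_period_period: "periodic r \<Longrightarrow> is_period r (period r)"
  unfolding period_def periodic_def by (rule LeastI_ex)

section \<open>The compressor network\<close>

lemma compressor_choice_cases:
  "compressor_choice X w s = w \<or> compressor_choice X w s = 1"
  by (cases X) auto

text \<open>A visit to 2 or 3 begins with a departure from 1 and has ended in a departure unless the
  particle is still there. An exit to a target is a hit at the moment of arrival, so hits are
  counted up to and including time \<open>t\<close>.\<close>

lemma compressor_invariant:
  assumes "range r = {1, 2}" "configuration (compressor_network X Y r) t = (v, c)"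
  shows "v \<in> {1, 2, 3, 4, 5} \<and> (\<forall>w. w \<notin> {1, 2, 3} \<longrightarrow> c w = 0) \<and>
    card {k. k < c 1 \<and> r k = 1} = c 2 + of_bool (v = 2) \<and>
    card {k. k < c 1 \<and> r k = 2} = c 3 + of_bool (v = 3) \<and>
    card {s. s < Suc t \<and> position (compressor_network X Y r) s \<in> {4, 5}} =
      card {k. k < c 2 \<and> compressor_choice X 4 (r k) = 4} +
      card {k. k < c 3 \<and> compressor_choice Y 5 (r k) = 5}"
  using assms(2)
proof (induction t arbitrary: v c)
  case 0
  then show ?case
    by (auto simp: position_def compressor_network_def)
next
  case (Suc t)
  let ?N = "compressor_network X Y r"
  obtain w d where wd: "configuration ?N t = (w, d)"
    by fastforce
  have step: "(v, c) = rr_step ?N (w, d)"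
    using Suc.prems wd by simp
  have pos: "position ?N (Suc t) = v"
    unfolding position_def Suc.prems by simp
  have r: "r k = 1 \<or> r k = 2" for k
    using assms(1) by blast
  note IH = Suc.IH[OF wd]
  then consider "w = 1" | "w = 2" | "w = 3" | "w \<in> {4, 5}"
    by blast
  then show ?case
  proof cases
    case 1
    with step have "v = (if r (d 1) = 1 then 2 else 3)" "c = d(1 := Suc (d 1))"
      by (auto simp: rr_step_def compressor_network_def)
    with IH 1 r[of "d 1"] show ?thesis
      by (auto simp: card_Collect_less_Suc[of "Suc t"] pos card_Collect_less_Suc[of "d (Suc 0)"])
  next
    case 2
    with step have "v = compressor_choice X 4 (r (d 2))" "c = d(2 := Suc (d 2))"
      by (auto simp: rr_step_def compressor_network_def)
    with IH 2 compressor_choice_cases[of X 4 "r (d 2)"] show ?thesis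
      by (auto simp: card_Collect_less_Suc[of "Suc t"] pos card_Collect_less_Suc[of "d 2"])
  next
    case 3
    with step have "v = compressor_choice Y 5 (r (d 3))" "c = d(3 := Suc (d 3))"
      by (auto simp: rr_step_def compressor_network_def)
    with IH 3 compressor_choice_cases[of Y 5 "r (d 3)"] show ?thesis
      by (auto simp: card_Collect_less_Suc[of "Suc t"] pos card_Collect_less_Suc[of "d 3"])
  next
    case 4
    with step have "v = 1" "c = d"
      by (auto simp: rr_step_def compressor_network_def)
    with IH 4 show ?thesis
      by (auto simp: card_Collect_less_Suc[of "Suc t"] pos)
  qed
qed

text \<open>The particle cannot get stuck: after a departure from 1 it comes back from 2 or 3 either
  directly or through a target.\<close>

lemma compressor_returns:
  "\<exists>t c. configuration (compressor_network X Y r) t = (1, c) \<and> c 1 = n"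
proof (induction n)
  case 0
  show ?case
    by (rule exI[of _ 0]) (simp add: compressor_network_def)
next
  case (Suc n)
  let ?N = "compressor_network X Y r"
  from Suc obtain t c where t: "configuration ?N t = (1, c)" "c 1 = n"
    by blast
  define w where "w = (if r n = 1 then 2 else 3 :: nat)"
  define d where "d = c(1 := Suc n)"
  define v where "v = (if w = 2 then compressor_choice X 4 (r (d 2)) else compressor_choice Y 5 (r (d 3)))"
  have 1: "configuration ?N (Suc t) = (w, d)"
    using t by (simp add: rr_step_def compressor_network_def w_def d_def)
  have 2: "configuration ?N (Suc (Suc t)) = (v, d(w := Suc (d w)))"
    using 1 by (simp add: rr_step_def compressor_network_def v_def) (simp add: w_def)
  have d: "(d(w := Suc (d w))) 1 = Suc n"
    by (simp add: d_def w_def)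
  have "v = 1 \<or> v \<in> {4, 5}"
    using compressor_choice_cases[of X 4 "r (d 2)"] compressor_choice_cases[of Y 5 "r (d 3)"]
    by (auto simp: v_def)
  then show ?case
  proof
    assume "v = 1"
    with 2 d show ?thesis by metis
  next
    assume "v \<in> {4, 5}"
    with 2 have "configuration ?N (Suc (Suc (Suc t))) = (1, d(w := Suc (d w)))"
      by (auto simp: rr_step_def compressor_network_def)
    with d show ?thesis by metis
  qed
qed

text \<open>All four variants are treated at once. \<open>period r\<close> need not be the least
  period of the output, whence an inequality in the theorem.\<close>

lemma is_period_compressor:
  assumes "balanced r"
  shows "is_period (compressor X Y r) (period r)"
proof -
  let ?N = "compressor_network X Y r"
  define p where "p = period r"
  have "periodic r" and range: "range r = {1, 2}"
    using assms by (auto simp: balanced_def two_state_rotor_type_def)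
  then have p: "0 < p" "\<And>k. r (k + p) = r k"
    using is_period_period[of r] by (auto simp: is_period_def p_def)
  have r: "r k = 1 \<or> r k = 2" for k
    using range by blast
  define m where "m = card {k. k < p \<and> r k = 1}"
  have m: "card {k. k < p \<and> r k = 1} = m" "card {k. k < p \<and> r k = 2} = m"
    using assms by (simp_all add: balanced_def m_def p_def)
  have "{k. k < p \<and> r k = 1} \<union> {k. k < p \<and> r k = 2} = {..<p}"
    using r by auto
  moreover have "card ({k. k < p \<and> r k = 1} \<union> {k. k < p \<and> r k = 2}) = m + m"
    by (subst card_Un_disjoint) (auto simp: m[simplified])
  ultimately have pm: "p = m + m"
    by simp
  \<comment> \<open>Either variant exits in exactly one of the two states, and balance makes both
    equally frequent. \<open>w \<noteq> 1\<close> keeps an exit distinct from a return to the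
    source.\<close>
  have exits: "card {k. k < p \<and> compressor_choice Z w (r k) = w} = m" if "w \<noteq> 1" for Z w
  proof -
    have "compressor_choice Z w (r k) = w \<longleftrightarrow> r k = (case Z of U \<Rightarrow> 2 | D \<Rightarrow> 1)" for k
      using r[of k] that by (cases Z) auto
    then show ?thesis
      using m by (cases Z) simp_all
  qed
  \<comment> \<open>One period of departures from 1 would advance the rotors at 2 and 3 by only half
    a period, so two are taken. At the source no visit to 2 or 3 is pending.\<close>
  obtain T c where T: "configuration ?N T = (1, c)" "c 1 = p + p"
    using compressor_returns by blast
  note inv = compressor_invariant[OF range T(1)]
  have count: "card {k. k < p + p \<and> r k = s} = card {k. k < p \<and> r k = s} + card {k. k < p \<and> r k = s}" for s
    by (rule card_Collect_less_add) (simp add: p(2))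
  have c: "c 2 = p" "c 3 = p"
    using inv T(2) count[of 1] count[of 2] m pm by simp_all
  \<comment> \<open>The invariant counts hits through time \<open>T\<close> itself; as the source is
    no target, the count over times below \<open>T\<close> is the same.\<close>
  have "position ?N T = 1"
    by (simp add: position_def T(1))
  then have hits: "card {t. t < T \<and> position ?N t \<in> {4, 5}} = p"
    using inv exits[of 4 X] exits[of 5 Y] pm c by (simp add: card_Collect_less_Suc)
  have "is_period (hitting_sequence ?N) p"
  proof (rule is_period_hitting_sequence)
    show "configuration ?N T = (source ?N, c)"
      using T(1) by (simp add: compressor_network_def)
    show "card {t. t < T \<and> position ?N t \<in> targets ?N} = p"
      using hits by (simp add: compressor_network_def)
    have "r (k + c v) = r k" for v k
    proof (cases "v \<in> {1, 2, 3}")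
      case True
      then show ?thesis
        using p(2)[of k] p(2)[of "k + p"] T(2) c by (auto simp: add.assoc)
    next
      \<comment> \<open>The rotor condition ranges over all naturals outside the targets, including
        non-vertices; there the counter is still 0.\<close>
      case False
      then show ?thesis using inv by simp
    qed
    then show "rotor ?N v (k + c v) = rotor ?N v k" for v k
      by (simp add: compressor_network_def)
  qed (fact p(1))
  then show ?thesis
    by (simp add: is_period_def compressor_def p_def)
qed

theorem theorem5p5:
  fixes r :: "nat \<Rightarrow> nat"
  assumes "balanced r"
  shows "period (compressor U U r) \<le> period r \<and>
         period (compressor U D r) \<le> period r \<and>
         period (compressor D U r) \<le> period r \<and>
         period (compressor D D r) \<le> period r"
  using assms by (simp add: period_le is_period_compressor)

end
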